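(* Every positive multiple of $10$ arises as the combinatorial period of a rotationally symmetric periodic billiard trajectory on the regular pentagon.
   Context: The billiard table is a regular pentagon; a billiard trajectory moves along straight lines, reflecting at sides with equal angles of incidence and reflection, and never hits a vertex. The combinatorial period of a periodic billiard trajectory is the number of bounces in one primitive period. It is rotationally symmetric if, as a subset of the pentagon, it is invariant under rotation by $2\pi/5$ about the center. *)

theory Defs
  imports "HOL-Analysis.Analysis"
begin

text \<open>
  The table is the regular pentagon in the complex plane with centre \<open>0\<close> and circumradius \<open>1\<close>;
  its vertices are \<open>vertex 0, ..., vertex 4\<close>, in counterclockwise order, and
  \<open>vertex 5 = vertex 0\<close>.
\<close>

definition vertex :: "nat \<Rightarrow> complex" where
  "vertex k = cis (2 * pi * real k / 5)"

definition side_direction :: "nat \<Rightarrow> complex" where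
  "side_direction k = sgn (vertex (Suc k) - vertex k)"

text \<open>Sides are relatively open: bouncing at a vertex is not allowed.\<close>

definition side :: "nat \<Rightarrow> complex set" where
  "side k = open_segment (vertex k) (vertex (Suc k))"

text \<open>
  The reflection of a vector in the line spanned by the unit vector \<open>d\<close>. It keeps the
  component of \<open>v\<close> along \<open>d\<close> and negates the component orthogonal to \<open>d\<close>.
\<close>

definition reflect :: "complex \<Rightarrow> complex \<Rightarrow> complex" where
  "reflect d v = d\<^sup>2 * cnj v"

text \<open>
  A billiard trajectory is given by its bi-infinite sequence \<open>p\<close> of bounce points, \<open>s n\<close> being
  the side that contains \<open>p n\<close>. Between two bounces it moves on a chord joining two different
  sides. Equality of the angles of incidence and reflection says that the outgoing unit direction
  is the mirror image in the side of the incoming one.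
\<close>

definition billiard_trajectory :: "(int \<Rightarrow> complex) \<Rightarrow> bool" where
  "billiard_trajectory p \<longleftrightarrow>
     (\<exists>s :: int \<Rightarrow> nat. \<forall>n.
        s n < 5 \<and> p n \<in> side (s n) \<and> s (n + 1) \<noteq> s n \<and>
        sgn (p (n + 1) - p n) = reflect (side_direction (s n)) (sgn (p n - p (n - 1))))"

text \<open>
  The incoming and outgoing directions at every bounce are determined by the bounce points, so a
  period of the sequence of bounce points is the number of bounces in a period of the motion.
\<close>

definition bounce_period :: "(int \<Rightarrow> complex) \<Rightarrow> nat \<Rightarrow> bool" where
  "bounce_period p m \<longleftrightarrow> 0 < m \<and> (\<forall>n. p (n + int m) = p n)"

definition periodic_trajectory :: "(int \<Rightarrow> complex) \<Rightarrow> bool" where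
  "periodic_trajectory p \<longleftrightarrow> billiard_trajectory p \<and> (\<exists>m. bounce_period p m)"

text \<open>Meaningful for periodic trajectories only.\<close>

definition combinatorial_period :: "(int \<Rightarrow> complex) \<Rightarrow> nat" where
  "combinatorial_period p = (LEAST m. bounce_period p m)"

definition trace :: "(int \<Rightarrow> complex) \<Rightarrow> complex set" where
  "trace p = (\<Union>n. closed_segment (p n) (p (n + 1)))"

definition rotationally_symmetric :: "(int \<Rightarrow> complex) \<Rightarrow> bool" where
  "rotationally_symmetric p \<longleftrightarrow> (\<lambda>z. cis (2 * pi / 5) * z) ` trace p = trace p"

end

theory Submission
  imports Defs
begin

text \<open>
  Unfolding turns a trajectory into a straight line on the surface made of a pentagon and its mirror
  image. A closed line that crosses \<open>2 * k\<close> sides there folds to a trajectory which, after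
  \<open>2 * k\<close> bounces, repeats itself up to a rotation by a multiple \<open>H\<close> of \<open>2 * pi / 5\<close>; if
  \<open>5\<close> does not divide \<open>H\<close>, the trajectory is rotationally symmetric and has period \<open>10 * k\<close>.
  Parallel to the base the surface splits into a cylinder of trapezoids and a cylinder of triangles.
  A line that winds around the first one, crossing \<open>2 * k - 1\<close> of its slanted sides, and then crosses
  the base closes up with \<open>H = 4 * k - 2\<close>. This settles every \<open>k\<close> except those congruent to \<open>3\<close>
  modulo \<open>5\<close>, for which one uses lines that cross \<open>a\<close> slanted sides of the first cylinder and
  \<open>b\<close> of the second, where \<open>a + b = 2 * k\<close> and \<open>H = 2 * a + 4 * b\<close>.
\<close>

section \<open>The pentagon in a rotating frame\<close>

definition rot :: "int \<Rightarrow> complex" where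
  "rot k = cis (2 * pi * of_int k / 5)"

lemma rot_add: "rot (k + l) = rot k * rot l"
  by (simp add: rot_def cis_mult add_divide_distrib ring_distribs)

lemma rot_5 [simp]: "rot 5 = 1"
  by (simp add: rot_def)

lemma rot_0 [simp]: "rot 0 = 1"
  by (simp add: rot_def)

lemma rot_neq_0 [simp]: "rot k \<noteq> 0"
  by (simp add: rot_def)

lemma norm_rot [simp]: "norm (rot k) = 1"
  by (simp add: rot_def)

lemma cnj_rot: "cnj (rot k) = rot (- k)"
  by (simp add: rot_def cis_cnj)

lemma rot_5_mult [simp]: "rot (5 * k) = 1"
  using cis_multiple_2pi[of "of_int k"]
  by (simp add: rot_def mult.assoc del: cis_multiple_2pi)

lemma rot_mod: "rot (k mod 5) = rot k"
proof -
  have "rot k = rot (5 * (k div 5) + k mod 5)"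
    by simp
  then show ?thesis
    unfolding rot_add by simp
qed

lemma rot_cong: "k mod 5 = l mod 5 \<Longrightarrow> rot k = rot l"
  by (metis rot_mod)

section \<open>The golden ratio and coordinates of the pentagon\<close>

definition phi :: real where
  "phi = 1 + 2 * cos (2 * pi / 5)"

text \<open>For x = 2 pi / 5 one has 3 x = 2 pi - 2 x, so cos x is a root of a cubic; splitting off
  the root 1 leaves the golden ratio equation.\<close>

lemma phi_square: "phi * phi = phi + 1"
proof -
  define c where "c = cos (2 * pi / 5)"
  have "3 * (2 * pi / 5) = 2 * pi - 2 * (2 * pi / 5)"
    by simp
  then have "cos (3 * (2 * pi / 5)) = cos (2 * (2 * pi / 5))"
    by (simp only: cos_2pi_minus)
  then have "4 * c ^ 3 - 3 * c = 2 * c\<^sup>2 - 1"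
    unfolding c_def by (simp only: cos_treble_cos cos_double_cos)
  then have "(c - 1) * (4 * c\<^sup>2 + 2 * c - 1) = 0"
    by (simp add: algebra_simps power2_eq_square power3_eq_cube)
  moreover have "c < 1"
    unfolding c_def using cos_monotone_0_pi[of 0 "2 * pi / 5"] pi_gt_zero by simp
  ultimately have "4 * c\<^sup>2 + 2 * c - 1 = 0"
    by simp
  then show ?thesis
    unfolding phi_def c_def[symmetric] by (simp add: algebra_simps power2_eq_square)
qed

lemma phi_bounds: "8 / 5 < phi" "phi < 5 / 3"
proof -
  have "0 < cos (2 * pi / 5)"
    by (rule cos_gt_zero) (use pi_gt_zero in auto)
  then have pos: "1 < phi"
    by (simp add: phi_def)
  show "8 / 5 < phi"
  proof (rule ccontr)
    assume "\<not> ?thesis"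
    \<comment> \<open>\<open>(phi - 1) * phi = 1\<close>, whereas 24/25 < 1 < 10/9; the second bound
      uses the other inequality.\<close>
    then have "(phi - 1) * phi \<le> (3 / 5) * (8 / 5)"
      using pos by (intro mult_mono) auto
    then show False
      using phi_square by (simp add: algebra_simps)
  qed
  show "phi < 5 / 3"
  proof (rule ccontr)
    assume "\<not> ?thesis"
    then have "(2 / 3) * (5 / 3) \<le> (phi - 1) * phi"
      by (intro mult_mono) auto
    then show False
      using phi_square by (simp add: algebra_simps)
  qed
qed

lemma sin_pos: "0 < sin (2 * pi / 5)"
  by (rule sin_gt_zero) (use pi_gt_zero in auto)

text \<open>
  The frame has \<open>side 2\<close> as its base, \<open>Re\<close> pointing up and \<open>Im\<close> pointing to the left;
  \<open>pt e t\<close> lies on the \<open>e\<close>-th side counted counterclockwise from the base.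
\<close>

definition pt :: "int \<Rightarrow> real \<Rightarrow> complex" where
  "pt e t = rot (2 + e) * ((1 - of_real t) + of_real t * rot 1)"

text \<open>
  Affine frame coordinates: the horizontal unit is the side of the pentagon, the vertical unit the
  height of the triangle that a diagonal cuts off, so that the trapezoid below the horizontal
  diagonal has height \<open>phi\<close>.
\<close>

definition fx :: "int \<Rightarrow> real \<Rightarrow> real" where
  "fx e t = (if e mod 5 = 0 then t - 1 / 2
    else if e mod 5 = 1 then 1 / 2 + (phi - 1) / 2 * t
    else if e mod 5 = 2 then phi / 2 * (1 - t)
    else if e mod 5 = 3 then - phi / 2 * t
    else - (1 / 2) - (phi - 1) / 2 * (1 - t))"

definition fy :: "int \<Rightarrow> real \<Rightarrow> real" where
  "fy e t = (if e mod 5 = 0 then 0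
    else if e mod 5 = 1 then phi * t
    else if e mod 5 = 2 then phi + t
    else if e mod 5 = 3 then phi + 1 - t
    else phi * (1 - t))"

definition unit_x :: real where
  "unit_x = 2 * (phi - 1) * sin (2 * pi / 5)"

definition unit_y :: real where
  "unit_y = (3 - phi) / 2"

lemma unit_y_pos: "0 < unit_y"
  using phi_bounds by (simp add: unit_y_def)

lemma rot_values:
  "rot 1 = Complex ((phi - 1) / 2) (sin (2 * pi / 5))"
  "rot 2 = Complex (- phi / 2) ((phi - 1) * sin (2 * pi / 5))"
  "rot 3 = Complex (- phi / 2) (- (phi - 1) * sin (2 * pi / 5))"
  "rot 4 = Complex ((phi - 1) / 2) (- sin (2 * pi / 5))"
proof -
  show r1: "rot 1 = Complex ((phi - 1) / 2) (sin (2 * pi / 5))"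
    by (simp add: rot_def phi_def complex_eq_iff)
  have "rot 2 = rot 1 * rot 1"
    by (simp flip: rot_add)
  then have "rot 2 = Complex ((phi - 1) / 2 * ((phi - 1) / 2) - sin (2 * pi / 5) * sin (2 * pi / 5))
      ((phi - 1) * sin (2 * pi / 5))"
    unfolding r1 by (simp add: complex_eq_iff)
  also have "sin (2 * pi / 5) * sin (2 * pi / 5) = 1 - (phi - 1) / 2 * ((phi - 1) / 2)"
    using sin_cos_squared_add[of "2 * pi / 5"] by (simp add: phi_def power2_eq_square)
  also have "(phi - 1) / 2 * ((phi - 1) / 2) - (1 - (phi - 1) / 2 * ((phi - 1) / 2)) = - phi / 2"
    using phi_square by (simp add: field_simps)
  finally show r2: "rot 2 = Complex (- phi / 2) ((phi - 1) * sin (2 * pi / 5))" .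
  have "rot 3 = cnj (rot 2)" "rot 4 = cnj (rot 1)"
    unfolding cnj_rot by (rule rot_cong; simp)+
  then show "rot 3 = Complex (- phi / 2) (- (phi - 1) * sin (2 * pi / 5))"
    "rot 4 = Complex ((phi - 1) / 2) (- sin (2 * pi / 5))"
    unfolding r1 r2 by (simp_all add: complex_eq_iff algebra_simps)
qed

lemma rot_1_neq_1: "rot 1 \<noteq> 1"
  using sin_pos by (auto simp: rot_values complex_eq_iff)

lemma pt_eq: "pt e t = Complex (unit_y * fy e t - phi / 2) (- (unit_x * fx e t))"
proof -
  have eq: "pt e t = (1 - of_real t) * rot (2 + e) + of_real t * rot (3 + e)"
    using rot_add[of "2 + e" 1] by (simp add: pt_def algebra_simps)
  have pp: "phi * (phi * z) = phi * z + z" for z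
    using phi_square by (metis distrib_right mult.assoc mult_1)
  have red: "rot (c + e) = rot (c + e mod 5)" for c
    by (rule rot_cong) presburger
  have "e mod 5 = 0 \<or> e mod 5 = 1 \<or> e mod 5 = 2 \<or> e mod 5 = 3 \<or> e mod 5 = 4"
    by presburger
  moreover have "rot 6 = rot 1" "rot 7 = rot 2"
    by (rule rot_cong; simp)+
  note this[simp]
  ultimately show ?thesis
    unfolding eq red[of 2] red[of 3]
    by (elim disjE)
      (simp_all add: rot_values fx_def fy_def unit_x_def unit_y_def complex_eq_iff pp phi_square field_simps)
qed

lemma pt_rot: "rot k * pt e t = pt (e + k) t"
  by (simp add: pt_def rot_add mult_ac)

lemma pt_mod: "pt (e mod 5) t = pt e t"
proof -
  have "rot (2 + e mod 5) = rot (2 + e)"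
    by (rule rot_cong) presburger
  then show ?thesis
    by (simp add: pt_def)
qed

lemma pt_inj: "pt e t = pt e t' \<Longrightarrow> t = t'"
proof -
  assume "pt e t = pt e t'"
  then have "(1 - of_real t) + of_real t * rot 1 = (1 - of_real t') + of_real t' * rot 1"
    by (simp add: pt_def)
  then have "(of_real t - of_real t') * (rot 1 - 1) = 0"
    by (simp add: algebra_simps)
  with rot_1_neq_1 show ?thesis
    by simp
qed

text \<open>Once side \<open>e\<close> is turned to the base, its line has height 0, while interior
  points of the other sides lie strictly above it.\<close>

lemma pt_side_unique:
  assumes "pt e t = pt e' t'" "0 < t'" "t' < 1"
  shows "5 dvd e - e'"
proof (rule ccontr)
  assume "\<not> ?thesis"
  then have ne: "(e' - e) mod 5 \<noteq> 0"
    by presburger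
  have "pt 0 t = pt (e' - e) t'"
    using assms(1) pt_rot[of "- e" e t] pt_rot[of "- e" e' t'] by simp
  then have "fy 0 t = fy (e' - e) t'"
    unfolding pt_eq using unit_y_pos by simp
  moreover have "0 < fy (e' - e) t'"
    using ne assms phi_bounds by (auto simp: fy_def)
  ultimately show False
    by (simp add: fy_def)
qed

lemma closed_segment_rot:
  assumes "z \<in> closed_segment a b"
  shows "rot k * z \<in> closed_segment (rot k * a) (rot k * b)"
proof -
  obtain u where u: "0 \<le> u" "u \<le> 1" and z: "z = (1 - u) *\<^sub>R a + u *\<^sub>R b"
    using assms unfolding in_segment by blast
  have "rot k * z = (1 - u) *\<^sub>R (rot k * a) + u *\<^sub>R (rot k * b)"
    unfolding z by (simp add: distrib_left)
  with u show ?thesis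
    unfolding in_segment by blast
qed

lemma vertex_eq: "vertex k = rot (int k)"
  by (simp add: vertex_def rot_def)

lemma pt_in_side:
  assumes "0 < t" "t < 1"
  shows "pt e t \<in> side (nat ((2 + e) mod 5))"
proof -
  define k where "k = nat ((2 + e) mod 5)"
  have k: "int k = (2 + e) mod 5"
    by (simp add: k_def)
  have v: "vertex k = rot (2 + e)"
    unfolding vertex_eq k by (rule rot_mod)
  have "vertex (Suc k) = rot (int k) * rot 1"
    unfolding vertex_eq by (simp flip: rot_add add: add.commute)
  then have v': "vertex (Suc k) = rot (2 + e) * rot 1"
    using v by (simp add: vertex_eq)
  have ne: "vertex k \<noteq> vertex (Suc k)"
    unfolding v v' using rot_1_neq_1 by simp
  have "pt e t = (1 - t) *\<^sub>R vertex k + t *\<^sub>R vertex (Suc k)"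
    unfolding v v' pt_def by (simp add: scaleR_conv_of_real algebra_simps)
  with assms ne show ?thesis
    unfolding side_def k_def[symmetric] in_segment by blast
qed

text \<open>For a side vector w, the square of \<open>sgn w\<close> is w / \<open>cnj w\<close>, and
  \<open>cnj (rot 1 - 1) = - rot (- 1) * (rot 1 - 1)\<close>.\<close>

lemma reflect_side:
  "reflect (side_direction k) z = - rot (2 * int k + 1) * cnj z"
proof -
  define w where "w = rot (int k) * (rot 1 - 1)"
  have w: "vertex (Suc k) - vertex k = w"
    unfolding w_def vertex_eq by (simp add: rot_add algebra_simps)
  have w0: "w \<noteq> 0"
    using rot_1_neq_1 by (simp add: w_def)
  have "rot (2 * int k + 1) = rot (int k) * rot (int k) * rot 1"
    by (simp flip: rot_add)
  moreover have "cnj w = rot (- int k) * (rot (-1) - 1)"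
    by (simp add: w_def cnj_rot)
  moreover have "rot 1 * rot (-1) = 1" "rot (int k) * rot (- int k) = 1"
    by (simp_all flip: rot_add)
  ultimately have "- rot (2 * int k + 1) * cnj w = w"
    unfolding w_def by algebra
  then have "w * w = - rot (2 * int k + 1) * (w * cnj w)"
    by (metis mult.assoc mult.left_commute)
  also have "w * cnj w = of_real (norm w) ^ 2"
    using complex_norm_square[of w] by simp
  finally have "(sgn w)\<^sup>2 = - rot (2 * int k + 1)"
    using w0 by (simp add: sgn_eq power2_eq_square field_simps)
  then show ?thesis
    by (simp add: reflect_def side_direction_def w)
qed

lemma sgn_mult_rot: "sgn (rot k * z) = rot k * sgn z"
  by (simp add: sgn_eq norm_mult)

lemma sgn_pos_mult: "0 < c \<Longrightarrow> sgn (of_real c * z) = sgn z" for z :: complex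
  by (simp add: sgn_mult sgn_of_real)

section \<open>Unfolded lines\<close>

text \<open>
  Reflecting the table instead of the ray turns the trajectory into a straight line of slope \<open>1 / s\<close>.
  Every copy of the table that the line meets is, up to a rotation \<open>rot (R n)\<close>, the pentagon of the
  frame or its mirror image; reading all copies in the frame makes the vertical direction \<open>g\<close> of the
  chords alternate. In the frame the chord after bounce \<open>n\<close> ends on side \<open>e (n + 1)\<close>, and crossing
  side \<open>e\<close> rotates the frame by \<open>2 * e\<close>, so that the next chord starts on side \<open>- e\<close>.
\<close>

locale unfolded_line =
  fixes e R :: "int \<Rightarrow> int" and t g :: "int \<Rightarrow> real" and s :: real and L :: nat and H :: int
  assumes s_pos: "0 < s" and L_pos: "0 < L"
    and t_pos: "0 < t n" and t_less: "t n < 1"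
    and g_Suc: "g (n + 1) = - g n"
    and chord_right: "fx (- e n) (t n) < fx (e (n + 1)) (t (n + 1))"
    and chord_slope: "(fx (e (n + 1)) (t (n + 1)) - fx (- e n) (t n)) * g (n + 1)
        = s * (fy (e (n + 1)) (t (n + 1)) - fy (- e n) (t n))"
    and sides_differ: "\<not> 5 dvd e n + e (n + 1)"
    and R_Suc: "R (n + 1) = R n + 2 * e (n + 1)"
    and e_period: "e (n + int L) = e n" and t_period: "t (n + int L) = t n"
    and R_period: "R (n + int L) = R n + H"
    and holonomy: "\<not> 5 dvd H"
    and primitive: "\<lbrakk>\<And>n. 5 dvd (e (n + m) + e (n + m + 1)) - (e n + e (n + 1)); \<And>n. t (n + m) = t n\<rbrakk>
        \<Longrightarrow> int L dvd m"
begin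

section \<open>Folding the line back to a trajectory\<close>

definition p :: "int \<Rightarrow> complex" where
  "p n = rot (R n) * pt (- e n) (t n)"

text \<open>Not normalised: \<open>s\<close> to the right for one unit up or down, with a minus sign
  because \<open>Im\<close> points left.\<close>

definition dir :: "int \<Rightarrow> complex" where
  "dir n = Complex (unit_y * g (n + 1)) (- (unit_x * s))"

lemma dir_Suc: "dir (n + 1) = - cnj (dir n)"
  unfolding dir_def g_Suc[of "n + 1"] by (simp add: complex_eq_iff)

lemma p_eq: "p n = pt (R n - e n) (t n)"
  by (simp add: p_def pt_rot)

lemma p_Suc: "p (n + 1) = rot (R n) * pt (e (n + 1)) (t (n + 1))"
  unfolding p_eq R_Suc by (simp add: pt_rot algebra_simps)

lemma chord: "\<exists>c>0. p (n + 1) - p n = rot (R n) * (of_real c * dir n)"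
proof -
  define dx dy where "dx = fx (e (n + 1)) (t (n + 1)) - fx (- e n) (t n)"
    and "dy = fy (e (n + 1)) (t (n + 1)) - fy (- e n) (t n)"
  have "dx * g (n + 1) = s * dy"
    unfolding dx_def dy_def by (rule chord_slope)
  then have dy: "dy = dx / s * g (n + 1)"
    using s_pos by (simp add: field_simps)
  have "p (n + 1) - p n = rot (R n) * (pt (e (n + 1)) (t (n + 1)) - pt (- e n) (t n))"
    by (simp only: p_Suc p_def[of n] right_diff_distrib)
  also have "pt (e (n + 1)) (t (n + 1)) - pt (- e n) (t n) = Complex (unit_y * dy) (- (unit_x * dx))"
    unfolding pt_eq dx_def dy_def by (simp add: complex_eq_iff algebra_simps)
  also have "Complex (unit_y * dy) (- (unit_x * dx)) = of_real (dx / s) * dir n"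
    unfolding dy using s_pos by (simp add: dir_def complex_eq_iff)
  finally show ?thesis
    using chord_right[of n] s_pos by (intro exI[of _ "dx / s"]) (simp add: dx_def)
qed

lemma sgn_chord: "sgn (p (n + 1) - p n) = rot (R n) * sgn (dir n)"
  using chord[of n] by (auto simp: sgn_mult_rot sgn_pos_mult)

lemma billiard_trajectory_p: "billiard_trajectory p"
proof -
  define \<sigma> where "\<sigma> n = nat ((2 + (R n - e n)) mod 5)" for n
  have \<sigma>: "int (\<sigma> n) = (2 + (R n - e n)) mod 5" for n
    by (simp add: \<sigma>_def)
  have "\<sigma> n < 5 \<and> p n \<in> side (\<sigma> n) \<and> \<sigma> (n + 1) \<noteq> \<sigma> n \<and>
      sgn (p (n + 1) - p n) = reflect (side_direction (\<sigma> n)) (sgn (p n - p (n - 1)))" for n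
  proof (intro conjI)
    show "\<sigma> n < 5"
      using \<sigma>[of n] by presburger
    show "p n \<in> side (\<sigma> n)"
      unfolding p_eq \<sigma>_def using t_pos t_less by (rule pt_in_side)
    show "\<sigma> (n + 1) \<noteq> \<sigma> n"
    proof
      assume "\<sigma> (n + 1) = \<sigma> n"
      then have "(2 + (R (n + 1) - e (n + 1))) mod 5 = (2 + (R n - e n)) mod 5"
        by (metis \<sigma>)
      then have "5 dvd 2 + (R (n + 1) - e (n + 1)) - (2 + (R n - e n))"
        by (simp only: mod_eq_dvd_iff)
      moreover have "2 + (R (n + 1) - e (n + 1)) - (2 + (R n - e n)) = e n + e (n + 1)"
        by (simp add: R_Suc)
      ultimately show False
        using sides_differ[of n] by (simp only:)
    qed
    have R: "R n = R (n - 1) + 2 * e n"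
      using R_Suc[of "n - 1"] by simp
    \<comment> \<open>Frame side x is table side 2 + x; the shift disappears mod 5 because 2 * 2 + 1
      = 5.\<close>
    have mod: "(2 * ((2 + x) mod 5) + 1) mod 5 = (2 * x) mod 5" for x :: int
    proof -
      have "(2 * ((2 + x) mod 5) + 1) mod 5 = (2 * (2 + x) + 1) mod 5"
        by (metis mod_add_left_eq mod_mult_right_eq)
      also have "2 * (2 + x) + 1 = 2 * x + 5"
        by simp
      finally show ?thesis
        by simp
    qed
    \<comment> \<open>The bounce side is the mean of the rotations before and after the bounce, so
      the reflection carries one frame to the next.\<close>
    have "R n + R (n - 1) = 2 * (R n - e n)"
      using R by simp
    then have "rot (2 * int (\<sigma> n) + 1) = rot (R n + R (n - 1))"
      by (intro rot_cong) (simp only: \<sigma> mod)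
    then have "- rot (2 * int (\<sigma> n) + 1) * cnj (rot (R (n - 1)) * sgn (dir (n - 1)))
        = rot (R n + R (n - 1)) * rot (- R (n - 1)) * (- cnj (sgn (dir (n - 1))))"
      by (simp add: cnj_rot)
    also have "rot (R n + R (n - 1)) * rot (- R (n - 1)) = rot (R n)"
      by (simp flip: rot_add)
    also have "- cnj (sgn (dir (n - 1))) = sgn (dir n)"
      using dir_Suc[of "n - 1"] by (simp add: sgn_eq)
    finally show "sgn (p (n + 1) - p n) = reflect (side_direction (\<sigma> n)) (sgn (p n - p (n - 1)))"
      using sgn_chord[of "n - 1"] by (simp add: sgn_chord reflect_side)
  qed
  then show ?thesis
    unfolding billiard_trajectory_def by blast
qed

section \<open>Period and rotational symmetry\<close>

lemma period_mult:
  "e (n + int L * q) = e n \<and> t (n + int L * q) = t n \<and> R (n + int L * q) = R n + H * q"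
proof (induction q arbitrary: n rule: int_induct[of _ 0])
  case base
  then show ?case by simp
next
  case (step1 i)
  have "n + int L * (i + 1) = (n + int L) + int L * i"
    by (simp add: algebra_simps)
  then show ?case
    using step1(2)[of "n + int L"] by (simp add: e_period t_period R_period algebra_simps)
next
  case (step2 i)
  have "n + int L * (i - 1) = (n - int L) + int L * i"
    by (simp add: algebra_simps)
  then show ?case
    using step2(2)[of "n - int L"] e_period[of "n - int L"] t_period[of "n - int L"]
      R_period[of "n - int L"] by (simp add: algebra_simps)
qed

lemma p_period: "p (n + int L * q) = rot (H * q) * p n"
  using period_mult[of n q] by (simp add: p_def rot_add)

lemma bounce_period_p: "bounce_period p (5 * L)"
proof -
  have "p (n + int (5 * L)) = p n" for n
    using p_period[of n 5] rot_5_mult[of H] by (simp only: mult.commute of_nat_mult of_nat_numeral mult_1)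
  then show ?thesis
    using L_pos by (simp add: bounce_period_def)
qed

text \<open>A bounce point determines \<open>t n\<close> and, mod 5, \<open>R n - e n\<close>. The
  latter grows by \<open>e n + e (n + 1)\<close>, hence the form of \<open>primitive\<close>. It
  gives m = L q, and the rotation by H q is trivial only if 5 divides q.\<close>

lemma bounce_period_dvd:
  assumes "bounce_period p m"
  shows "5 * L dvd m"
proof -
  have eq: "pt (R (n + int m) - e (n + int m)) (t (n + int m)) = pt (R n - e n) (t n)" for n
    using assms by (simp add: bounce_period_def flip: p_eq)
  then have side: "5 dvd (R (n + int m) - e (n + int m)) - (R n - e n)" for n
    using t_pos t_less by (rule pt_side_unique)
  have "t (n + int m) = t n" for n
  proof -
    have "pt (R (n + int m) - e (n + int m)) (t n) = pt (R n - e n) (t n)"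
      using side[of n] by (metis mod_eq_dvd_iff pt_mod)
    then show ?thesis
      using eq[of n] pt_inj by metis
  qed
  moreover have "5 dvd (e (n + int m) + e (n + int m + 1)) - (e n + e (n + 1))" for n
  proof -
    have shift: "n + 1 + int m = n + int m + 1"
      by simp
    have "(e (n + int m) + e (n + int m + 1)) - (e n + e (n + 1))
        = ((R (n + 1 + int m) - e (n + 1 + int m)) - (R (n + 1) - e (n + 1)))
          - ((R (n + int m) - e (n + int m)) - (R n - e n))"
      unfolding shift R_Suc by simp
    with side[of n] side[of "n + 1"] show ?thesis
      by (metis dvd_diff)
  qed
  ultimately have "int L dvd int m"
    by (intro primitive)
  then obtain q where q: "int m = int L * q" ..
  then have "5 dvd H * q"
    using side[of 0] period_mult[of 0 q] by simp
  moreover have "prime (5 :: int)"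
    by simp
  ultimately have "5 dvd q"
    using holonomy by (meson prime_dvd_mult_iff)
  then have "int (5 * L) dvd int m"
    unfolding q by (simp add: mult.commute)
  then show ?thesis
    by (simp only: int_dvd_int_iff)
qed

lemma combinatorial_period_p: "combinatorial_period p = 5 * L"
  unfolding combinatorial_period_def
proof (rule Least_equality)
  show "bounce_period p (5 * L)"
    by (rule bounce_period_p)
  show "5 * L \<le> m" if "bounce_period p m" for m
    using bounce_period_dvd[OF that] that by (intro dvd_imp_le) (auto simp: bounce_period_def)
qed

lemma rot_trace:
  assumes "z \<in> trace p"
  shows "rot (H * q) * z \<in> trace p"
proof -
  obtain n where "z \<in> closed_segment (p n) (p (n + 1))"
    using assms by (auto simp: trace_def)
  then have "rot (H * q) * z \<in> closed_segment (rot (H * q) * p n) (rot (H * q) * p (n + 1))"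
    by (rule closed_segment_rot)
  moreover have "rot (H * q) * p (n + 1) = p (n + int L * q + 1)"
    using p_period[of "n + 1" q] by (simp add: add_ac)
  ultimately show ?thesis
    unfolding trace_def by (auto simp flip: p_period)
qed

text \<open>\<open>H\<close> is invertible mod 5, so some multiple of \<open>L\<close> bounces turns
  the trajectory by exactly 2 pi / 5.\<close>

lemma rotationally_symmetric_p: "rotationally_symmetric p"
proof -
  have "H mod 5 \<in> {1, 2, 3, 4}"
    using holonomy by (simp add: dvd_eq_mod_eq_0) presburger
  then have "\<exists>q. ((H mod 5) * q) mod 5 = 1"
    by (elim insertE) (auto intro: exI[of _ 1] exI[of _ 2] exI[of _ 3] exI[of _ 4])
  then obtain q where q: "(H * q) mod 5 = 1"
    unfolding mod_mult_left_eq by blast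
  have r: "rot (H * q) = cis (2 * pi / 5)" "rot (H * (- q)) * cis (2 * pi / 5) = 1"
  proof -
    show "rot (H * q) = cis (2 * pi / 5)"
      using q rot_cong[of "H * q" 1] by (simp add: rot_def)
    then show "rot (H * (- q)) * cis (2 * pi / 5) = 1"
      by (metis add.left_inverse mult_minus_right rot_0 rot_add)
  qed
  show ?thesis
    unfolding rotationally_symmetric_def
  proof (intro equalityI subsetI)
    fix z
    assume "z \<in> trace p"
    then have "rot (H * (- q)) * z \<in> trace p"
      by (rule rot_trace)
    moreover have "z = cis (2 * pi / 5) * (rot (H * (- q)) * z)"
      using r(2) by (simp add: mult_ac)
    ultimately show "z \<in> (\<lambda>z. cis (2 * pi / 5) * z) ` trace p"
      by blast
  qed (auto simp: rot_trace simp flip: r(1))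
qed

lemma symmetric_trajectory:
  "\<exists>p. periodic_trajectory p \<and> rotationally_symmetric p \<and> combinatorial_period p = 5 * L"
  using billiard_trajectory_p bounce_period_p rotationally_symmetric_p combinatorial_period_p
  unfolding periodic_trajectory_def by blast

end

section \<open>Two families of closed lines\<close>

definition alt :: "int \<Rightarrow> real" where
  "alt n = (if even n then 1 else - 1)"

lemma alt_Suc: "alt (n + 1) = - alt n"
  by (simp add: alt_def)

lemma alt_pred: "alt n = - alt (n + 1)"
  by (simp add: alt_def)

lemma alt_cases: "alt n = 1 \<or> alt n = - 1"
  by (simp add: alt_def)

text \<open>
  \<open>link s g e t e' t'\<close>: from side \<open>e\<close>, seen as \<open>- e\<close> after crossing it, the line reaches side \<open>e'\<close>.
\<close>

definition link :: "real \<Rightarrow> real \<Rightarrow> int \<Rightarrow> real \<Rightarrow> int \<Rightarrow> real \<Rightarrow> bool" where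
  "link s g e t e' t' \<longleftrightarrow> fx (- e) t < fx e' t'
     \<and> (fx e' t' - fx (- e) t) * g = s * (fy e' t' - fy (- e) t) \<and> \<not> 5 dvd e + e'"

lemma mod_Suc_int:
  fixes n l :: int
  assumes "0 < l"
  shows "(n + 1) mod l = (if n mod l = l - 1 then 0 else n mod l + 1)"
    and "(n + 1) div l = (if n mod l = l - 1 then n div l + 1 else n div l)"
proof -
  have b: "0 \<le> n mod l" "n mod l < l"
    using assms by simp_all
  have n: "n + 1 = l * (n div l) + (n mod l + 1)"
    by simp
  have "(n + 1) mod l = (if n mod l = l - 1 then 0 else n mod l + 1)
      \<and> (n + 1) div l = (if n mod l = l - 1 then n div l + 1 else n div l)"
  proof (cases "n mod l = l - 1")
    case True
    then have "n + 1 = l * (n div l + 1)"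
      using n by (simp add: distrib_left)
    with True assms show ?thesis
      by simp
  next
    case False
    then have "n mod l + 1 < l" "0 \<le> n mod l + 1"
      using b by simp_all
    with False int_div_pos_eq[OF n] int_mod_pos_eq[OF n] show ?thesis
      by simp
  qed
  then show "(n + 1) mod l = (if n mod l = l - 1 then 0 else n mod l + 1)"
    "(n + 1) div l = (if n mod l = l - 1 then n div l + 1 else n div l)"
    by simp_all
qed

text \<open>
  Here \<open>E\<close>, \<open>T\<close>, \<open>S\<close> describe one period of the unfolded line, with \<open>S\<close> the accumulated rotation.
  The predicate \<open>Q\<close> recognises position \<open>c\<close> from data of the folded trajectory only, which excludes
  smaller periods.
\<close>

lemma block_trajectory:
  fixes E S :: "int \<Rightarrow> int" and T :: "int \<Rightarrow> real" and l H c :: int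
    and Q :: "int \<Rightarrow> int \<Rightarrow> real \<Rightarrow> bool"
  assumes s: "0 < s" and l: "0 < l" "even l"
    and T: "\<And>i. \<lbrakk>0 \<le> i; i < l\<rbrakk> \<Longrightarrow> 0 < T i \<and> T i < 1"
    and E: "\<And>i. \<lbrakk>0 \<le> i; i < l\<rbrakk> \<Longrightarrow> 0 \<le> E i \<and> E i \<le> 2"
    and step: "\<And>i. \<lbrakk>0 \<le> i; i + 1 < l\<rbrakk> \<Longrightarrow>
      link s (\<epsilon> * alt (i + 1)) (E i) (T i) (E (i + 1)) (T (i + 1)) \<and> S (i + 1) = S i + 2 * E (i + 1)"
    and wrap: "link s \<epsilon> (E (l - 1)) (T (l - 1)) (E 0) (T 0)" "H + S 0 = S (l - 1) + 2 * E 0"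
    and H: "\<not> 5 dvd H"
    and c: "0 \<le> c" "c < l"
    and marker: "\<And>i. \<lbrakk>0 \<le> i; i < l\<rbrakk> \<Longrightarrow>
      Q (E i + E ((i + 1) mod l)) (E ((i + 1) mod l) + E ((i + 2) mod l)) (T i) \<longleftrightarrow> i = c"
  shows "\<exists>p. periodic_trajectory p \<and> rotationally_symmetric p \<and> combinatorial_period p = 5 * nat l"
proof -
  define e where "e n = E (n mod l)" for n
  define t where "t n = T (n mod l)" for n
  define R where "R n = n div l * H + S (n mod l)" for n
  have b: "0 \<le> n mod l" "n mod l < l" for n
    using l by simp_all
  \<comment> \<open>Even \<open>l\<close> lets the alternation of vertical directions continue
    across the seam between blocks.\<close>
  have alt_mod: "alt (n mod l) = alt n" for n
    using l(2) by (simp add: alt_def dvd_mod_iff)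
  have L: "link s (\<epsilon> * alt (n + 1)) (e n) (t n) (e (n + 1)) (t (n + 1)) \<and> R (n + 1) = R n + 2 * e (n + 1)"
    for n
  proof (cases "n mod l = l - 1")
    case True
    then have m: "(n + 1) mod l = 0" "(n + 1) div l = n div l + 1"
      using mod_Suc_int[OF l(1), of n] by simp_all
    have "alt (n + 1) = 1"
      using alt_mod[of "n + 1"] m(1) by (simp add: alt_def)
    then show ?thesis
      unfolding e_def t_def R_def m True using wrap by (simp add: algebra_simps)
  next
    case False
    then have m: "(n + 1) mod l = n mod l + 1" "(n + 1) div l = n div l"
      using mod_Suc_int[OF l(1), of n] by simp_all
    have "n mod l + 1 < l"
      using False b[of n] by simp
    moreover have "alt (n mod l + 1) = alt (n + 1)"
      by (simp add: alt_Suc alt_mod)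
    ultimately show ?thesis
      unfolding e_def t_def R_def m using step[OF b(1)[of n]] by simp
  qed
  interpret unfolded_line e R t "\<lambda>n. \<epsilon> * alt n" s "nat l" H
  proof
    fix n m
    show "0 < s" "\<not> 5 dvd H" "0 < nat l"
      using s H l by simp_all
    show "0 < t n" "t n < 1"
      using T b by (simp_all add: t_def)
    show "\<epsilon> * alt (n + 1) = - (\<epsilon> * alt n)"
      by (simp add: alt_Suc)
    show "fx (- e n) (t n) < fx (e (n + 1)) (t (n + 1))"
      "(fx (e (n + 1)) (t (n + 1)) - fx (- e n) (t n)) * (\<epsilon> * alt (n + 1))
        = s * (fy (e (n + 1)) (t (n + 1)) - fy (- e n) (t n))"
      "\<not> 5 dvd e n + e (n + 1)" "R (n + 1) = R n + 2 * e (n + 1)"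
      using L[of n] unfolding link_def by blast+
    show "e (n + int (nat l)) = e n" "t (n + int (nat l)) = t n" "R (n + int (nat l)) = R n + H"
      using l by (simp_all add: e_def t_def R_def algebra_simps)
    assume f: "5 dvd (e (n + m) + e (n + m + 1)) - (e n + e (n + 1))" for n
    assume tm: "t (n + m) = t n" for n
    \<comment> \<open>Both sums lie between 0 and 4, so congruence mod 5 is equality.\<close>
    have eq: "e (n + m) + e (n + m + 1) = e n + e (n + 1)" for n
    proof -
      have "0 \<le> e k \<and> e k \<le> 2" for k
        using E b by (simp add: e_def)
      then have "\<bar>(e (n + m) + e (n + m + 1)) - (e n + e (n + 1))\<bar> < 5"
        by (smt (verit))
      with f[of n] dvd_imp_le_int[of "(e (n + m) + e (n + m + 1)) - (e n + e (n + 1))" 5] show ?thesis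
        by fastforce
    qed
    have Q: "Q (e n + e (n + 1)) (e (n + 1) + e (n + 1 + 1)) (t n) \<longleftrightarrow> n mod l = c" for n
      using marker[OF b, of n] by (simp add: e_def t_def mod_simps add.assoc)
    have "c mod l = c"
      using c by simp
    with Q[of c] Q[of "c + m"] eq[of c] eq[of "c + 1"] tm[of c] have "(c + m) mod l = c"
      by (simp add: algebra_simps)
    then have "l dvd m"
      using c by (metis \<open>c mod l = c\<close> add_diff_cancel_left' mod_eq_dvd_iff)
    then show "int (nat l) dvd m"
      using l by simp
  qed
  show ?thesis
    by (rule symmetric_trajectory)
qed

section \<open>Slope equations for single chords\<close>

lemma fx_values:
  "fx 0 t = t - 1 / 2" "fx 1 t = 1 / 2 + (phi - 1) / 2 * t" "fx 2 t = phi / 2 * (1 - t)"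
  "fx (- 2) t = - phi / 2 * t" "fx (- 1) t = - (1 / 2) - (phi - 1) / 2 * (1 - t)"
  by (simp_all add: fx_def)

lemma fy_values:
  "fy 0 t = 0" "fy 1 t = phi * t" "fy 2 t = phi + t" "fy (- 2) t = phi + 1 - t" "fy (- 1) t = phi * (1 - t)"
  by (simp_all add: fy_def)

lemma fx_pos:
  assumes "0 < t" "t < 1"
  shows "1 / 2 < fx 1 t" "0 < fx 2 t" "fx (- 2) t < 0" "fx (- 1) t < - (1 / 2)" "\<bar>fx 0 t\<bar> < 1 / 2"
proof -
  have "0 < (phi - 1) / 2 * t" "0 < phi / 2 * (1 - t)" "0 < phi / 2 * t" "0 < (phi - 1) / 2 * (1 - t)"
    using assms phi_bounds by (auto intro!: mult_pos_pos)
  then show "1 / 2 < fx 1 t" "0 < fx 2 t" "fx (- 2) t < 0" "fx (- 1) t < - (1 / 2)" "\<bar>fx 0 t\<bar> < 1 / 2"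
    unfolding fx_values using assms by linarith+
qed

text \<open>In offsets from the midpoints the slope equation separates into a term in
  \<open>t\<close> and a term in \<open>t'\<close>. Their difference is the midpoint distance, so
  along the strip these terms form an arithmetic progression.\<close>

lemma link_11:
  assumes "g = 1 \<or> g = - 1" "0 < t" "t < 1" "0 < t'" "t' < 1"
    and "(t - 1 / 2) * (- g * (phi * s) - (phi - 1) / 2) = A"
    and "(t' - 1 / 2) * (g * (phi * s) - (phi - 1) / 2) = A + (phi + 1) / 2"
  shows "link s g 1 t 1 t'"
proof -
  have "fx (- 1) t < fx 1 t'"
    using fx_pos[OF assms(2,3)] fx_pos[OF assms(4,5)] by linarith
  moreover have "(fx 1 t' - fx (- 1) t) * g = s * (fy 1 t' - fy (- 1) t)"
    using assms(1,6,7) unfolding fx_values fy_values by (auto simp: field_simps)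
  ultimately show ?thesis
    by (simp add: link_def)
qed

lemma link_22:
  assumes "g = 1 \<or> g = - 1" "0 < t" "t < 1" "0 < t'" "t' < 1"
    and "(t - 1 / 2) * (- g * s + phi / 2) = A"
    and "(t' - 1 / 2) * (g * s + phi / 2) = A + phi / 2"
  shows "link s g 2 t 2 t'"
proof -
  have "fx (- 2) t < fx 2 t'"
    using fx_pos[OF assms(2,3)] fx_pos[OF assms(4,5)] by linarith
  moreover have "(fx 2 t' - fx (- 2) t) * g = s * (fy 2 t' - fy (- 2) t)"
    using assms(1,6,7) unfolding fx_values fy_values by (auto simp: field_simps)
  ultimately show ?thesis
    by (simp add: link_def)
qed

lemma link_12:
  assumes "0 < t" "t < 1" "0 < t'" "t' < 1"
    and "(t - 1 / 2) * (phi * s + (phi - 1) / 2) + (t' - 1 / 2) * (s + phi / 2)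
      = phi / 2 + 1 / 4 - s * (phi + 1) / 2"
  shows "link s 1 1 t 2 t'"
proof -
  have "fx (- 1) t < fx 2 t'"
    using fx_pos[OF assms(1,2)] fx_pos[OF assms(3,4)] by linarith
  moreover have "(fx 2 t' - fx (- 1) t) * 1 = s * (fy 2 t' - fy (- 1) t)"
    using assms(5) unfolding fx_values fy_values by (simp add: field_simps)
  ultimately show ?thesis
    by (simp add: link_def)
qed

lemma link_21:
  assumes "0 < t" "t < 1" "0 < t'" "t' < 1"
    and "(t - 1 / 2) * (s + phi / 2) + (t' - 1 / 2) * (phi * s + (phi - 1) / 2)
      = s * (phi + 1) / 2 - phi / 2 - 1 / 4"
  shows "link s (- 1) 2 t 1 t'"
proof -
  have "fx (- 2) t < fx 1 t'"
    using fx_pos[OF assms(1,2)] fx_pos[OF assms(3,4)] by linarith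
  moreover have "(fx 1 t' - fx (- 2) t) * (- 1) = s * (fy 1 t' - fy (- 2) t)"
    using assms(5) unfolding fx_values fy_values by (simp add: field_simps)
  ultimately show ?thesis
    by (simp add: link_def)
qed

lemma link_10:
  assumes "0 < t" "t < 1" "0 < t'" "t' < 1"
    and "(t - 1 / 2) * (phi * s - (phi - 1) / 2) = phi * s / 2 - (t' - 1 / 2) - (phi + 1) / 4"
  shows "link s (- 1) 1 t 0 t'"
proof -
  have "fx (- 1) t < fx 0 t'"
    using fx_pos[OF assms(1,2)] fx_pos[OF assms(3,4)] by linarith
  moreover have "(fx 0 t' - fx (- 1) t) * (- 1) = s * (fy 0 t' - fy (- 1) t)"
    using assms(5) unfolding fx_values fy_values by (simp add: field_simps)
  ultimately show ?thesis
    by (simp add: link_def)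
qed

lemma link_01:
  assumes "0 < t" "t < 1" "0 < t'" "t' < 1"
    and "(t' - 1 / 2) * (phi * s - (phi - 1) / 2) = (phi + 1) / 4 - (t - 1 / 2) - phi * s / 2"
  shows "link s 1 0 t 1 t'"
proof -
  have "fx 0 t < fx 1 t'"
    using fx_pos[OF assms(1,2)] fx_pos[OF assms(3,4)] by linarith
  moreover have "(fx 1 t' - fx 0 t) * 1 = s * (fy 1 t' - fy 0 t)"
    using assms(5) unfolding fx_values fy_values by (simp add: field_simps)
  ultimately show ?thesis
    by (simp add: link_def)
qed

lemma quotient_in_unit:
  fixes A D :: real
  assumes "2 * \<bar>A\<bar> < \<bar>D\<bar>"
  shows "0 < 1 / 2 + A / D \<and> 1 / 2 + A / D < 1"
proof -
  have "\<bar>A / D\<bar> < 1 / 2"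
    using assms by (simp add: abs_divide divide_less_eq)
  then show ?thesis
    by linarith
qed


lemma phi_mult_phi: "phi * (phi * z) = phi * z + z"
  using phi_square by (metis distrib_right mult.assoc mult_1)

text \<open>
  The side sequence is \<open>1\<close> (\<open>a\<close> times), \<open>0\<close>. Unrolled, the trapezoids form a strip in which
  consecutive slanted sides have midpoints \<open>(phi + 1) / 2\<close> apart; \<open>A i / D i\<close> is the offset
  from the midpoint at which the line meets the \<open>i\<close>-th of them. It crosses the base at distance \<open>1 / 4\<close> from the midpoint: through the midpoint
  itself the trajectory would have period \<open>5\<close> when \<open>a = 1\<close>.
\<close>

lemma trajectory_1_0:
  assumes a: "0 < a" "odd a" and H: "\<not> 5 dvd a"
  shows "\<exists>p. periodic_trajectory p \<and> rotationally_symmetric p \<and> combinatorial_period p = 5 * nat (a + 1)"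
proof -
  \<comment> \<open>Between two crossings of a base the line climbs \<open>phi\<close> and advances
    \<open>a\<close> midpoint distances: \<open>phi * s = a * (phi + 1) / 2\<close>.\<close>
  define s where "s = a * phi / 2"
  define A where "A i = (2 * of_int i + 1 - of_int a) * (phi + 1) / 4 + 1 / 4" for i :: int
  define D where "D i = alt i * (phi * s) - (phi - 1) / 2" for i
  define E :: "int \<Rightarrow> int" where "E i = (if i < a then 1 else 0)" for i
  define T where "T i = (if i < a then 1 / 2 + A i / D i else 1 / 4)" for i
  define S where "S i = (if i < a then 2 * (i + 1) else 2 * a)" for i
  have ra: "1 \<le> real_of_int a"
    using a by simp
  have phi_s: "phi * s = a * (phi + 1) / 2"
    by (simp add: s_def algebra_simps phi_mult_phi)
  have a_le: "phi + 1 \<le> a * (phi + 1)"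
    using ra phi_bounds by simp
  \<comment> \<open>The estimates leave 2 |D| - 4 |A| at least 1.\<close>
  have AD: "2 * \<bar>A i\<bar> < \<bar>D i\<bar>" if "0 \<le> i" "i < a" for i
  proof -
    have "\<bar>2 * real_of_int i + 1 - a\<bar> \<le> a - 1"
      using that by simp
    then have "\<bar>2 * real_of_int i + 1 - a\<bar> * (phi + 1) \<le> (a - 1) * (phi + 1)"
      using phi_bounds by (intro mult_right_mono) auto
    also have "(a - 1) * (phi + 1) = a * (phi + 1) - (phi + 1)"
      by (simp add: algebra_simps)
    also have "\<bar>2 * real_of_int i + 1 - a\<bar> * (phi + 1) = \<bar>4 * A i - 1\<bar>"
      using phi_bounds by (simp add: A_def abs_mult)
    finally have "4 * \<bar>A i\<bar> \<le> a * (phi + 1) - phi"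
      by linarith
    moreover have "D i = a * (phi + 1) / 2 - (phi - 1) / 2 \<or> D i = - (a * (phi + 1) / 2) - (phi - 1) / 2"
      using alt_cases[of i] unfolding D_def phi_s by auto
    then have "a * (phi + 1) / 2 - (phi - 1) / 2 \<le> \<bar>D i\<bar>"
      using phi_bounds by argo
    ultimately show ?thesis
      using phi_bounds by (simp add: field_simps)
  qed
  have T01: "0 < T i" "T i < 1" if "0 \<le> i" for i
    using quotient_in_unit[OF AD] that by (auto simp: T_def)
  have TD: "(T i - 1 / 2) * (alt i * (phi * s) - (phi - 1) / 2) = A i" if "0 \<le> i" "i < a" for i
    unfolding D_def[symmetric] using AD[OF that] that by (auto simp: T_def)
  have A_Suc: "A (i + 1) = A i + (phi + 1) / 2" for i
    by (simp add: A_def field_simps)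
  have alt_a: "alt a = - 1" "alt (a - 1) = 1" "alt 0 = 1"
    using a by (simp_all add: alt_def)
  show ?thesis
  proof (rule block_trajectory[where E = E and S = S and T = T and s = s and \<epsilon> = 1 and H = "2 * a" and c = a
        and Q = "\<lambda>v w t. v = 1 \<and> t = 1 / 4"])
    show "0 < s"
      using ra phi_bounds by (simp add: s_def)
    show "0 < a + 1" "even (a + 1)" "0 \<le> a" "a < a + 1"
      using a by simp_all
    show "\<not> 5 dvd 2 * a"
      using H by presburger
    show "2 * a + S 0 = S (a + 1 - 1) + 2 * E 0"
      using a by (simp add: S_def E_def)
    fix i :: int
    assume i: "0 \<le> i"
    show "0 < T i \<and> T i < 1" "0 \<le> E i \<and> E i \<le> 2"
      using T01[OF i] by (simp_all add: E_def)
    show "link s (1 * alt (i + 1)) (E i) (T i) (E (i + 1)) (T (i + 1)) \<and> S (i + 1) = S i + 2 * E (i + 1)"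
      if "i + 1 < a + 1"
    proof (cases "i + 1 = a")
      case True
      then have ia: "i = a - 1"
        by simp
      have "link s (- 1) 1 (T i) 0 (T a)"
        unfolding ia
      proof (rule link_10)
        have "A (a - 1) = phi * s / 2 - (T a - 1 / 2) - (phi + 1) / 4"
          by (simp add: A_def T_def phi_s field_simps)
        then show "(T (a - 1) - 1 / 2) * (phi * s - (phi - 1) / 2) = phi * s / 2 - (T a - 1 / 2) - (phi + 1) / 4"
          using TD[of "a - 1"] a by (simp add: alt_a)
      qed (use T01 a in simp_all)
      then show ?thesis
        using a by (simp add: ia alt_a E_def S_def)
    next
      case False
      then have ia: "i + 1 < a"
        using that by simp
      have "link s (alt (i + 1)) 1 (T i) 1 (T (i + 1))"
        by (rule link_11[OF alt_cases T01 T01 TD[of i, unfolded alt_pred[of i]] TD[of "i + 1", unfolded A_Suc]])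
          (use i ia in simp_all)
      then show ?thesis
        using ia by (simp add: E_def S_def)
    qed
    show "(E i + E ((i + 1) mod (a + 1)) = 1 \<and> T i = 1 / 4) \<longleftrightarrow> i = a" if ia: "i < a + 1"
    proof -
      consider "i = a" | "i = a - 1" | "i + 1 < a"
        using ia by linarith
      then show ?thesis
      proof cases
        case 1
        then show ?thesis
          using a by (simp add: E_def T_def)
      next
        case 2
        \<comment> \<open>Position \<open>a - 1\<close> has side sum 1 too; it is told apart from
          \<open>a\<close> because its \<open>T\<close> exceeds 1/2.\<close>
        have "0 < A i"
          using ra phi_bounds by (simp add: A_def 2 add_nonneg_pos)
        moreover have "0 < D i"
          using a_le phi_bounds unfolding 2 D_def alt_a phi_s mult_1 by argo
        ultimately have "1 / 2 < T i"
          using 2 by (simp add: T_def)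
        then show ?thesis
          using 2 by auto
      next
        case 3
        then show ?thesis
          using i by (simp add: E_def)
      qed
    qed
  next
    have "link s 1 0 (T a) 1 (T 0)"
    proof (rule link_01)
      have "A 0 = (phi + 1) / 4 - (T a - 1 / 2) - phi * s / 2"
        by (simp add: A_def T_def phi_s field_simps)
      then show "(T 0 - 1 / 2) * (phi * s - (phi - 1) / 2) = (phi + 1) / 4 - (T a - 1 / 2) - phi * s / 2"
        using TD[of 0] a by (simp add: alt_a)
    qed (use T01 a in simp_all)
    then show "link s 1 (E (a + 1 - 1)) (T (a + 1 - 1)) (E 0) (T 0)"
      using a by (simp add: E_def)
  qed
qed

text \<open>
  The side sequence is \<open>1\<close> (\<open>a\<close> times), \<open>2\<close> (\<open>b\<close> times). The line runs through the centres of
  both strips, which determines its slope; \<open>\<bar>a - b\<bar> \<le> 2\<close> keeps it away from the vertices.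
\<close>

lemma trajectory_1_2:
  assumes a: "3 \<le> a" "odd a" and b: "0 < b" "odd b" and ab: "\<bar>a - b\<bar> \<le> 2"
    and H: "\<not> 5 dvd a + 2 * b"
  shows "\<exists>p. periodic_trajectory p \<and> rotationally_symmetric p \<and> combinatorial_period p = 5 * nat (a + b)"
proof -
  \<comment> \<open>One period climbs both strips, of total height \<open>phi + 1\<close>, and
    advances \<open>a * (phi + 1) / 2 + b * phi / 2\<close>.\<close>
  define s where "s = (a + b * (phi - 1)) / 2"
  define A where "A i = (2 * of_int i + 1 - of_int a) * (phi + 1) / 4" for i :: int
  define B where "B i = (2 * of_int (i - a) + 1 - of_int b) * phi / 4" for i :: int
  define C where "C i = - alt i * (phi * s) - (phi - 1) / 2" for i
  define D where "D i = - alt i * s + phi / 2" for i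
  define E :: "int \<Rightarrow> int" where "E i = (if i < a then 1 else 2)" for i
  define T where "T i = 1 / 2 + (if i < a then A i / C i else B i / D i)" for i
  define S where "S i = (if i < a then 2 * (i + 1) else 2 * a + 4 * (i - a + 1))" for i
  have ra: "3 \<le> real_of_int a" "1 \<le> real_of_int b" "real_of_int a \<le> b + 2" "real_of_int b \<le> a + 2"
    using a b ab by linarith+
  have phi_s: "phi * s = (a * phi + b) / 2"
    by (simp add: s_def algebra_simps phi_mult_phi)
  have s_phi: "s * (phi + 1) = (a * phi + b) / 2 + s"
    using phi_s by (simp add: algebra_simps)
  have a_le: "3 * phi \<le> a * phi" and b_le: "phi \<le> b * phi"
    using ra phi_bounds by simp_all
  have AC: "2 * \<bar>A i\<bar> < \<bar>C i\<bar>" if i: "0 \<le> i" "i < a" for i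
  proof (cases "even i")
    \<comment> \<open>Here 2 |C| - 4 |A| is at least b - a + 2 phi, positive since a - b is at most
      2; for \<open>B\<close> and \<open>D\<close> the margin is a - b + 2 phi.\<close>
    case True
    have "\<bar>2 * real_of_int i + 1 - a\<bar> \<le> a - 1"
      using i by simp
    then have "\<bar>2 * real_of_int i + 1 - a\<bar> * (phi + 1) \<le> (a - 1) * (phi + 1)"
      using phi_bounds by (intro mult_right_mono) auto
    then have "4 * \<bar>A i\<bar> \<le> (a - 1) * (phi + 1)"
      using phi_bounds by (simp add: A_def abs_mult)
    moreover have "C i = - ((a * phi + b) / 2) - (phi - 1) / 2"
      using True by (simp add: C_def phi_s alt_def field_simps)
    then have "\<bar>C i\<bar> = (a * phi + b) / 2 + (phi - 1) / 2"
      using a_le ra phi_bounds by argo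
    ultimately show ?thesis
      using phi_bounds ra by (simp add: field_simps)
  next
    case False
    \<comment> \<open>The denominator is smaller at odd \<open>i\<close>, but the extreme positions
      0 and \<open>a - 1\<close> are even. In the second strip the parities are exchanged.\<close>
    then have "1 \<le> i" "i \<le> a - 2"
      using i a by presburger+
    then have "\<bar>2 * real_of_int i + 1 - a\<bar> \<le> a - 3"
      by simp
    then have "\<bar>2 * real_of_int i + 1 - a\<bar> * (phi + 1) \<le> (a - 3) * (phi + 1)"
      using phi_bounds by (intro mult_right_mono) auto
    then have "4 * \<bar>A i\<bar> \<le> (a - 3) * (phi + 1)"
      using phi_bounds by (simp add: A_def abs_mult)
    moreover have "C i = (a * phi + b) / 2 - (phi - 1) / 2"
      using False by (simp add: C_def phi_s alt_def field_simps)
    then have "\<bar>C i\<bar> = (a * phi + b) / 2 - (phi - 1) / 2"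
      using a_le ra phi_bounds by argo
    ultimately show ?thesis
      using phi_bounds ra by (simp add: field_simps)
  qed
  have BD: "2 * \<bar>B i\<bar> < \<bar>D i\<bar>" if i: "a \<le> i" "i < a + b" for i
  proof (cases "even i")
    case True
    then have "a + 1 \<le> i" "i \<le> a + b - 2"
      using i a b by presburger+
    then have "\<bar>2 * real_of_int (i - a) + 1 - b\<bar> \<le> b - 3"
      by (simp add: abs_le_iff)
    then have "\<bar>2 * real_of_int (i - a) + 1 - b\<bar> * phi \<le> (b - 3) * phi"
      using phi_bounds by (intro mult_right_mono) auto
    then have "4 * \<bar>B i\<bar> \<le> (b - 3) * phi"
      using phi_bounds by (simp add: B_def abs_mult)
    moreover have "s - phi / 2 \<le> \<bar>D i\<bar>"
      using True unfolding D_def by (simp add: alt_def)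
    ultimately show ?thesis
      using phi_bounds ra by (simp add: s_def field_simps)
  next
    case False
    have "\<bar>2 * real_of_int (i - a) + 1 - b\<bar> \<le> b - 1"
      using i by (auto simp: abs_le_iff)
    then have "\<bar>2 * real_of_int (i - a) + 1 - b\<bar> * phi \<le> (b - 1) * phi"
      using phi_bounds by (intro mult_right_mono) auto
    then have "4 * \<bar>B i\<bar> \<le> (b - 1) * phi"
      using phi_bounds by (simp add: B_def abs_mult)
    moreover have "s + phi / 2 \<le> \<bar>D i\<bar>"
      using False unfolding D_def by (simp add: alt_def)
    ultimately show ?thesis
      using phi_bounds ra by (simp add: s_def field_simps)
  qed
  have T01: "0 < T i" "T i < 1" if "0 \<le> i" "i < a + b" for i
    using quotient_in_unit[OF AC] quotient_in_unit[OF BD] that by (auto simp: T_def)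
  have TA: "(T i - 1 / 2) * (- alt i * (phi * s) - (phi - 1) / 2) = A i" if "0 \<le> i" "i < a" for i
    unfolding C_def[symmetric] using AC[OF that] that by (auto simp: T_def)
  have TB: "(T i - 1 / 2) * (- alt i * s + phi / 2) = B i" if "a \<le> i" "i < a + b" for i
    unfolding D_def[symmetric] using BD[OF that] that by (auto simp: T_def)
  have A_Suc: "A (i + 1) = A i + (phi + 1) / 2" and B_Suc: "B (i + 1) = B i + phi / 2" for i
    by (simp_all add: A_def B_def field_simps)
  have neg_alt: "- alt n = 1 \<or> - alt n = - 1" for n
    using alt_cases[of n] by auto
  have alts: "alt a = - 1" "alt (a - 1) = 1" "alt 0 = 1" "alt (a + b - 1) = - 1"
    using a b by (simp_all add: alt_def)
  show ?thesis
  proof (rule block_trajectory[where E = E and S = S and T = T and s = s and \<epsilon> = "- 1"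
        and H = "2 * a + 4 * b" and c = "a - 2" and Q = "\<lambda>v w t. v = 2 \<and> w = 3"])
    show "0 < s"
      using ra phi_bounds by (simp add: s_def add_pos_nonneg)
    show "0 < a + b" "even (a + b)" "0 \<le> a - 2" "a - 2 < a + b"
      using a b by simp_all
    have "2 * a + 4 * b = 2 * (a + 2 * b)"
      by simp
    then show "\<not> 5 dvd 2 * a + 4 * b"
      using H by presburger
    show "2 * a + 4 * b + S 0 = S (a + b - 1) + 2 * E 0"
      using a b by (simp add: S_def E_def)
    fix i :: int
    assume i: "0 \<le> i"
    show "0 < T i \<and> T i < 1" if "i < a + b"
      using T01[OF i that] by simp
    show "0 \<le> E i \<and> E i \<le> 2"
      by (simp add: E_def)
    show "link s (- 1 * alt (i + 1)) (E i) (T i) (E (i + 1)) (T (i + 1)) \<and> S (i + 1) = S i + 2 * E (i + 1)"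
      if ib: "i + 1 < a + b"
    proof -
      consider "i + 1 < a" | "i = a - 1" | "a \<le> i"
        by linarith
      then show ?thesis
      proof cases
        case 1
        have "link s (- alt (i + 1)) 1 (T i) 1 (T (i + 1))"
          by (rule link_11[OF neg_alt T01 T01 TA[of i, unfolded alt_pred[of i]] TA[of "i + 1", unfolded A_Suc]])
            (use i ib 1 in simp_all)
        with 1 show ?thesis
          by (simp add: E_def S_def)
      next
        case 2
        have "link s 1 1 (T (a - 1)) 2 (T a)"
        proof (rule link_12)
          have "(T (a - 1) - 1 / 2) * (- (phi * s) - (phi - 1) / 2) = A (a - 1)"
            "(T a - 1 / 2) * (s + phi / 2) = B a"
            using TA[of "a - 1"] TB[of a] a b by (simp_all add: alts)
          moreover have "B a - A (a - 1) = phi / 2 + 1 / 4 - s * (phi + 1) / 2"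
            unfolding s_phi by (simp add: A_def B_def s_def field_simps)
          ultimately show "(T (a - 1) - 1 / 2) * (phi * s + (phi - 1) / 2) + (T a - 1 / 2) * (s + phi / 2)
              = phi / 2 + 1 / 4 - s * (phi + 1) / 2"
            by (simp add: algebra_simps)
        qed (use T01 a b in simp_all)
        with 2 show ?thesis
          using a by (simp add: alts E_def S_def)
      next
        case 3
        have "link s (- alt (i + 1)) 2 (T i) 2 (T (i + 1))"
          by (rule link_22[OF neg_alt T01 T01 TB[of i, unfolded alt_pred[of i]] TB[of "i + 1", unfolded B_Suc]])
            (use i ib 3 in simp_all)
        with 3 show ?thesis
          by (simp add: E_def S_def)
      qed
    qed
    \<comment> \<open>Consecutive sums 2 and 3 mark the sides 1, 1, 2, which occur once per
      period.\<close>
    show "(E i + E ((i + 1) mod (a + b)) = 2 \<and> E ((i + 1) mod (a + b)) + E ((i + 2) mod (a + b)) = 3)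
        \<longleftrightarrow> i = a - 2" if ib: "i < a + b"
    proof -
      consider "i + 2 < a" | "i = a - 2" | "i = a - 1" | "a \<le> i"
        by linarith
      then show ?thesis
        by cases (use a b i ib in \<open>auto simp: E_def\<close>)
    qed
  next
    have "link s (- 1) 2 (T (a + b - 1)) 1 (T 0)"
    proof (rule link_21)
      have "(T 0 - 1 / 2) * (- (phi * s) - (phi - 1) / 2) = A 0"
        "(T (a + b - 1) - 1 / 2) * (s + phi / 2) = B (a + b - 1)"
        using TA[of 0] TB[of "a + b - 1"] a b by (simp_all add: alts)
      moreover have "B (a + b - 1) - A 0 = s * (phi + 1) / 2 - phi / 2 - 1 / 4"
        unfolding s_phi by (simp add: A_def B_def s_def field_simps)
      ultimately show "(T (a + b - 1) - 1 / 2) * (s + phi / 2) + (T 0 - 1 / 2) * (phi * s + (phi - 1) / 2)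
          = s * (phi + 1) / 2 - phi / 2 - 1 / 4"
        by (simp add: algebra_simps)
    qed (use T01 a b in simp_all)
    then show "link s (- 1) (E (a + b - 1)) (T (a + b - 1)) (E 0) (T 0)"
      using a b by (simp add: E_def)
  qed
qed

theorem proposition4p2:
  fixes N :: nat
  assumes "N > 0" and "10 dvd N"
  shows "\<exists>p. periodic_trajectory p \<and> rotationally_symmetric p \<and> combinatorial_period p = N"
proof -
  obtain n where n: "N = 10 * n"
    using assms(2) ..
  define k where "k = int n"
  have k: "0 < k"
    using assms(1) n by (simp add: k_def)
  \<comment> \<open>5 divides 2 k - 1 exactly when k is 3 mod 5. Then \<open>a\<close> and
    \<open>b\<close> are to be odd with sum 2 k and nearly equal, whence the split by
    parity.\<close>
  consider "k mod 5 \<noteq> 3" | "k mod 5 = 3" "odd k" | "k mod 5 = 3" "even k"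
    by blast
  then show ?thesis
  proof cases
    case 1
    then have "\<not> 5 dvd 2 * k - 1"
      by presburger
    then show ?thesis
      using trajectory_1_0[of "2 * k - 1"] k by (simp add: n k_def nat_mult_distrib)
  next
    case 2
    then have "\<not> 5 dvd k + 2 * k" "3 \<le> k"
      using k by presburger+
    then show ?thesis
      using trajectory_1_2[of k k] 2 by (simp add: n k_def nat_mult_distrib)
  next
    case 3
    then have "\<not> 5 dvd (k + 1) + 2 * (k - 1)" "3 \<le> k"
      using k by presburger+
    then show ?thesis
      using trajectory_1_2[of "k + 1" "k - 1"] 3 by (simp add: n k_def nat_mult_distrib)
  qed
qed

end
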